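(* Let $\mathbf A=\langle A,+,\cdot,{}^{\alpha},0,1\rangle$ and $\mathbf B=\langle B,+,\cdot,{}^{\alpha},0,1\rangle$ be join $\sigma$-complete $\iota$-near semirings such that $\mathrm{Ce}(\mathbf A)$ and $\mathrm{Ce}(\mathbf B)$ are $\sigma$-complete Boolean algebras. If there are $a\in\mathrm{Ce}(\mathbf A)$ and $b\in\mathrm{Ce}(\mathbf B)$ such that $\mathbf A\cong[0,b]$ and $\mathbf B\cong[0,a]$, then $\mathbf A\cong\mathbf B$.
   Context: An $\iota$-near semiring (involutive idempotent integral near semiring) is an algebra $\mathbf A=\langle A,+,\cdot,{}^{\alpha},0,1\rangle$ of type $\langle 2,2,1,0,0\rangle$ such that: (i) $\langle A,+\rangle$ is a join semilattice with least element $0$ and greatest element $1$, with induced order $x\le y$ iff $x+y=y$; (ii) $x\cdot 1=x=1\cdot x$; (iii) $(x+y)\cdot z=(x\cdot z)+(y\cdot z)$; (iv) $x\cdot 0=0\cdot x=0$; (v) $(x^{\alpha})^{\alpha}=x$; (vi) $x\le y$ implies $y^{\alpha}\le x^{\alpha}$. Join $\sigma$-complete means every countable subset of $A$ has a join (supremum) with respect to $\le$. An element $e\in A$ is central if the principal congruences $\theta(e,0)$ and $\theta(e,1)$ form a pair of factor congruences, i.e. $\theta(e,0)\cap\theta(e,1)$ is the identity relation and $\theta(e,0)\circ\theta(e,1)=A\times A$. $\mathrm{Ce}(\mathbf A)$ denotes the set of central elements; it forms a Boolean algebra with meet $\cdot$, join $+$, complement ${}^{\alpha}$, and bounds $0,1$;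 $\sigma$-complete means every countable subset of $\mathrm{Ce}(\mathbf A)$ has a join and a meet in this Boolean algebra. For a central element $e$, $[0,e]=\{x\in A: x\le e\}$ is regarded as an algebra of the same type with operations $x+_e y=e\cdot(x+y)$, $x\cdot_e y=e\cdot(x\cdot y)$, $x^{\alpha_e}=e\cdot x^{\alpha}$ and constants $0$ and $e$. *)

theory Defs
  imports "HOL-Algebra.Ring" "HOL-Algebra.Order" "HOL-Library.Countable_Set"
begin

record 'a near_semiring = "'a ring" +
  invol :: "'a \<Rightarrow> 'a" (\<open>(\<open>notation=\<open>postfix invol\<close>\<close>_\<^sup>\<alpha>\<index>)\<close> [1000] 999)

definition nsr_le :: "'a near_semiring \<Rightarrow> 'a \<Rightarrow> 'a \<Rightarrow> bool" where
  "nsr_le A x y \<longleftrightarrow> x \<oplus>\<^bsub>A\<^esub> y = y"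

text \<open>Multiplication is neither associative nor left distributive in general.\<close>

locale iota_near_semiring =
  fixes A :: "'a near_semiring" (structure)
  assumes add_closed: "\<lbrakk>x \<in> carrier A; y \<in> carrier A\<rbrakk> \<Longrightarrow> x \<oplus> y \<in> carrier A"
    and mult_closed: "\<lbrakk>x \<in> carrier A; y \<in> carrier A\<rbrakk> \<Longrightarrow> x \<otimes> y \<in> carrier A"
    and invol_closed: "x \<in> carrier A \<Longrightarrow> x\<^sup>\<alpha> \<in> carrier A"
    and zero_closed: "\<zero> \<in> carrier A"
    and one_closed: "\<one> \<in> carrier A"
    and add_assoc: "\<lbrakk>x \<in> carrier A; y \<in> carrier A; z \<in> carrier A\<rbrakk>
          \<Longrightarrow> (x \<oplus> y) \<oplus> z = x \<oplus> (y \<oplus> z)"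
    and add_comm: "\<lbrakk>x \<in> carrier A; y \<in> carrier A\<rbrakk> \<Longrightarrow> x \<oplus> y = y \<oplus> x"
    and add_idem: "x \<in> carrier A \<Longrightarrow> x \<oplus> x = x"
    and zero_least: "x \<in> carrier A \<Longrightarrow> nsr_le A \<zero> x"
    and one_greatest: "x \<in> carrier A \<Longrightarrow> nsr_le A x \<one>"
    and mult_one_right: "x \<in> carrier A \<Longrightarrow> x \<otimes> \<one> = x"
    and mult_one_left: "x \<in> carrier A \<Longrightarrow> \<one> \<otimes> x = x"
    and right_distrib: "\<lbrakk>x \<in> carrier A; y \<in> carrier A; z \<in> carrier A\<rbrakk>
          \<Longrightarrow> (x \<oplus> y) \<otimes> z = (x \<otimes> z) \<oplus> (y \<otimes> z)"
    and mult_zero_right: "x \<in> carrier A \<Longrightarrow> x \<otimes> \<zero> = \<zero>"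
    and mult_zero_left: "x \<in> carrier A \<Longrightarrow> \<zero> \<otimes> x = \<zero>"
    and invol_invol: "x \<in> carrier A \<Longrightarrow> (x\<^sup>\<alpha>)\<^sup>\<alpha> = x"
    and invol_antitone: "\<lbrakk>x \<in> carrier A; y \<in> carrier A; nsr_le A x y\<rbrakk>
          \<Longrightarrow> nsr_le A (y\<^sup>\<alpha>) (x\<^sup>\<alpha>)"

definition nsr_order :: "'a near_semiring \<Rightarrow> 'a set \<Rightarrow> 'a gorder" where
  "nsr_order A S = \<lparr>carrier = S, eq = (=), le = nsr_le A\<rparr>"

definition join_sigma_complete :: "'a near_semiring \<Rightarrow> bool" where
  "join_sigma_complete A \<longleftrightarrow>
     (\<forall>X. X \<subseteq> carrier A \<and> countable X \<longrightarrow>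
        (\<exists>s. least (nsr_order A (carrier A)) s (Upper (nsr_order A (carrier A)) X)))"

definition nsr_congruence :: "'a near_semiring \<Rightarrow> ('a \<times> 'a) set \<Rightarrow> bool" where
  "nsr_congruence A \<theta> \<longleftrightarrow>
     equiv (carrier A) \<theta> \<and>
     (\<forall>x x' y y'. (x, x') \<in> \<theta> \<longrightarrow> (y, y') \<in> \<theta> \<longrightarrow>
        (x \<oplus>\<^bsub>A\<^esub> y, x' \<oplus>\<^bsub>A\<^esub> y') \<in> \<theta> \<and> (x \<otimes>\<^bsub>A\<^esub> y, x' \<otimes>\<^bsub>A\<^esub> y') \<in> \<theta>) \<and>
     (\<forall>x x'. (x, x') \<in> \<theta> \<longrightarrow> (x\<^sup>\<alpha>\<^bsub>A\<^esub>, x'\<^sup>\<alpha>\<^bsub>A\<^esub>) \<in> \<theta>)"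

definition principal_congruence :: "'a near_semiring \<Rightarrow> 'a \<Rightarrow> 'a \<Rightarrow> ('a \<times> 'a) set" where
  "principal_congruence A a b = \<Inter>{\<theta>. nsr_congruence A \<theta> \<and> (a, b) \<in> \<theta>}"

definition factor_congruences ::
  "'a near_semiring \<Rightarrow> ('a \<times> 'a) set \<Rightarrow> ('a \<times> 'a) set \<Rightarrow> bool" where
  "factor_congruences A \<theta> \<phi> \<longleftrightarrow>
     nsr_congruence A \<theta> \<and> nsr_congruence A \<phi> \<and>
     \<theta> \<inter> \<phi> = Id_on (carrier A) \<and> \<theta> O \<phi> = carrier A \<times> carrier A"

definition Ce :: "'a near_semiring \<Rightarrow> 'a set" where
  "Ce A = {e \<in> carrier A.
     factor_congruences A (principal_congruence A e \<zero>\<^bsub>A\<^esub>) (principal_congruence A e \<one>\<^bsub>A\<^esub>)}"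

text \<open>
  The central elements always form a Boolean algebra whose join is addition, so its order
  is the restriction of \<^const>\<open>nsr_le\<close>. Joins and meets are taken inside this Boolean
  algebra and need not agree with those of the whole near semiring.
\<close>

definition sigma_complete_center :: "'a near_semiring \<Rightarrow> bool" where
  "sigma_complete_center A \<longleftrightarrow>
     (\<forall>X. X \<subseteq> Ce A \<and> countable X \<longrightarrow>
        (\<exists>s. least (nsr_order A (Ce A)) s (Upper (nsr_order A (Ce A)) X)) \<and>
        (\<exists>i. greatest (nsr_order A (Ce A)) i (Lower (nsr_order A (Ce A)) X)))"

definition interval_algebra :: "'a near_semiring \<Rightarrow> 'a \<Rightarrow> 'a near_semiring" where
  "interval_algebra A e =
     \<lparr>carrier = {x \<in> carrier A. nsr_le A x e},
      monoid.mult = (\<lambda>x y. e \<otimes>\<^bsub>A\<^esub> (x \<otimes>\<^bsub>A\<^esub> y)),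
      one = e,
      zero = \<zero>\<^bsub>A\<^esub>,
      add = (\<lambda>x y. e \<otimes>\<^bsub>A\<^esub> (x \<oplus>\<^bsub>A\<^esub> y)),
      invol = (\<lambda>x. e \<otimes>\<^bsub>A\<^esub> x\<^sup>\<alpha>\<^bsub>A\<^esub>)\<rparr>"

definition nsr_iso :: "'a near_semiring \<Rightarrow> 'b near_semiring \<Rightarrow> ('a \<Rightarrow> 'b) set" where
  "nsr_iso A B = {h. bij_betw h (carrier A) (carrier B) \<and>
     (\<forall>x\<in>carrier A. \<forall>y\<in>carrier A.
        h (x \<oplus>\<^bsub>A\<^esub> y) = h x \<oplus>\<^bsub>B\<^esub> h y \<and> h (x \<otimes>\<^bsub>A\<^esub> y) = h x \<otimes>\<^bsub>B\<^esub> h y) \<and>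
     (\<forall>x\<in>carrier A. h (x\<^sup>\<alpha>\<^bsub>A\<^esub>) = (h x)\<^sup>\<alpha>\<^bsub>B\<^esub>) \<and>
     h \<zero>\<^bsub>A\<^esub> = \<zero>\<^bsub>B\<^esub> \<and> h \<one>\<^bsub>A\<^esub> = \<one>\<^bsub>B\<^esub>}"

definition nsr_isomorphic :: "'a near_semiring \<Rightarrow> 'b near_semiring \<Rightarrow> bool" where
  "nsr_isomorphic A B \<longleftrightarrow> nsr_iso A B \<noteq> {}"

end

theory Submission
  imports Defs
begin

text \<open>
  An element \<open>e\<close> is central iff any two unary maps that respect all congruences and agree at
  \<open>\<zero>\<close> and \<open>\<one>\<close> also agree at \<open>e\<close>. So an identity in a central variable need only be checked at
  \<open>\<zero>\<close> and \<open>\<one>\<close>, and this gives the Boolean operations on the centre, the near semiring structure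
  of \<open>[0,c]\<close>, and the equality of \<open>Ce [0,c]\<close> with \<open>Ce A \<inter> [0,c]\<close>.

  For the theorem, compose the two isomorphisms to \<open>f : A \<cong> [0,c]\<close> with \<open>c \<le> a\<close>, and let \<open>s\<close> be the
  join in \<open>Ce A\<close> of all \<open>f\<^sup>k(a\<^sup>\<alpha>)\<close>. As \<open>f\<close> preserves joins of central elements, \<open>s = a\<^sup>\<alpha> + f s\<close>, hence
  \<open>s\<^sup>\<alpha> = a \<cdot> (f s)\<^sup>\<alpha>\<close> is the complement of \<open>f s\<close> in \<open>[0,a]\<close>. Then \<open>A\<close> is the product of \<open>[0,s]\<close> and
  \<open>[0,s\<^sup>\<alpha>]\<close>, while \<open>[0,a]\<close> is the product of \<open>[0,f s]\<close>, which is isomorphic to \<open>[0,s]\<close> by \<open>f\<close>, and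
  the same \<open>[0,s\<^sup>\<alpha>]\<close>. Infinite products are avoided on purpose: a countable central partition
  of \<open>\<one>\<close> need not decompose \<open>A\<close>, since joins in \<open>Ce A\<close> may be larger than joins in \<open>A\<close>.
\<close>

section \<open>Maps that respect all congruences\<close>

text \<open>These maps include all unary polynomial functions of the algebra. The semantic condition
  avoids a syntax of terms and also covers maps conjugated by an isomorphism or cut down to an
  interval.\<close>

definition compatible :: "'a near_semiring \<Rightarrow> ('a \<Rightarrow> 'a) \<Rightarrow> bool" where
  "compatible A p \<longleftrightarrow> (\<forall>x\<in>carrier A. p x \<in> carrier A) \<and>
     (\<forall>\<theta>. nsr_congruence A \<theta> \<longrightarrow> (\<forall>x y. (x, y) \<in> \<theta> \<longrightarrow> (p x, p y) \<in> \<theta>))"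

lemma compatible_closed: "compatible A p \<Longrightarrow> x \<in> carrier A \<Longrightarrow> p x \<in> carrier A"
  by (simp add: compatible_def)

lemma compatible_congruence:
  "compatible A p \<Longrightarrow> nsr_congruence A \<theta> \<Longrightarrow> (x, y) \<in> \<theta> \<Longrightarrow> (p x, p y) \<in> \<theta>"
  by (simp add: compatible_def)

lemma compatible_id: "compatible A (\<lambda>x. x)"
  by (simp add: compatible_def)

lemma nsr_congruenceD:
  assumes "nsr_congruence A \<theta>"
  shows "equiv (carrier A) \<theta>"
    and "(x, x') \<in> \<theta> \<Longrightarrow> (y, y') \<in> \<theta> \<Longrightarrow> (x \<oplus>\<^bsub>A\<^esub> y, x' \<oplus>\<^bsub>A\<^esub> y') \<in> \<theta>"
    and "(x, x') \<in> \<theta> \<Longrightarrow> (y, y') \<in> \<theta> \<Longrightarrow> (x \<otimes>\<^bsub>A\<^esub> y, x' \<otimes>\<^bsub>A\<^esub> y') \<in> \<theta>"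
    and "(x, x') \<in> \<theta> \<Longrightarrow> (x\<^sup>\<alpha>\<^bsub>A\<^esub>, x'\<^sup>\<alpha>\<^bsub>A\<^esub>) \<in> \<theta>"
    and "x \<in> carrier A \<Longrightarrow> (x, x) \<in> \<theta>"
    and "(x, y) \<in> \<theta> \<Longrightarrow> (y, x) \<in> \<theta>"
    and "(x, y) \<in> \<theta> \<Longrightarrow> (y, z) \<in> \<theta> \<Longrightarrow> (x, z) \<in> \<theta>"
    and "(x, y) \<in> \<theta> \<Longrightarrow> x \<in> carrier A \<and> y \<in> carrier A"
  using assms unfolding nsr_congruence_def equiv_def refl_on_def
  by (auto dest: symD transD)

lemma nsr_congruenceI:
  assumes "\<And>x y. (x, y) \<in> \<theta> \<Longrightarrow> x \<in> carrier A \<and> y \<in> carrier A"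
    and "\<And>x. x \<in> carrier A \<Longrightarrow> (x, x) \<in> \<theta>"
    and "\<And>x y. (x, y) \<in> \<theta> \<Longrightarrow> (y, x) \<in> \<theta>"
    and "\<And>x y z. (x, y) \<in> \<theta> \<Longrightarrow> (y, z) \<in> \<theta> \<Longrightarrow> (x, z) \<in> \<theta>"
    and "\<And>x x' y y'. (x, x') \<in> \<theta> \<Longrightarrow> (y, y') \<in> \<theta> \<Longrightarrow> (x \<oplus>\<^bsub>A\<^esub> y, x' \<oplus>\<^bsub>A\<^esub> y') \<in> \<theta>"
    and "\<And>x x' y y'. (x, x') \<in> \<theta> \<Longrightarrow> (y, y') \<in> \<theta> \<Longrightarrow> (x \<otimes>\<^bsub>A\<^esub> y, x' \<otimes>\<^bsub>A\<^esub> y') \<in> \<theta>"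
    and "\<And>x x'. (x, x') \<in> \<theta> \<Longrightarrow> (x\<^sup>\<alpha>\<^bsub>A\<^esub>, x'\<^sup>\<alpha>\<^bsub>A\<^esub>) \<in> \<theta>"
  shows "nsr_congruence A \<theta>"
proof -
  have "equiv (carrier A) \<theta>"
    by (intro equivI refl_onI symI transI subrelI)
      (use assms(1) in simp, erule assms(2), erule assms(3), erule assms(4))
  then show ?thesis
    unfolding nsr_congruence_def using assms(5-7) by blast
qed

section \<open>Elementary arithmetic and order\<close>

context iota_near_semiring
begin

lemmas closed [simp, intro] =
  add_closed mult_closed invol_closed zero_closed one_closed

lemma zero_add [simp]: "x \<in> carrier A \<Longrightarrow> \<zero> \<oplus> x = x"
  using zero_least nsr_le_def by metis

lemma add_zero [simp]: "x \<in> carrier A \<Longrightarrow> x \<oplus> \<zero> = x"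
  using add_comm by force

lemma add_one [simp]: "x \<in> carrier A \<Longrightarrow> x \<oplus> \<one> = \<one>"
  using one_greatest nsr_le_def by metis

lemma one_add [simp]: "x \<in> carrier A \<Longrightarrow> \<one> \<oplus> x = \<one>"
  using add_comm by force

lemmas mult_simps [simp] =
  mult_one_right mult_one_left mult_zero_right mult_zero_left add_idem invol_invol

lemma invol_zero [simp]: "\<zero>\<^sup>\<alpha> = \<one>"
proof -
  have "nsr_le A ((\<one>\<^sup>\<alpha>)\<^sup>\<alpha>) (\<zero>\<^sup>\<alpha>)"
    by (intro invol_antitone zero_least closed)
  then show ?thesis by (simp add: nsr_le_def)
qed

lemma invol_one [simp]: "\<one>\<^sup>\<alpha> = \<zero>"
  using invol_invol[OF zero_closed] by simp

lemma nsr_le_trans: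
  assumes "nsr_le A x y" "nsr_le A y z" "x \<in> carrier A" "y \<in> carrier A" "z \<in> carrier A"
  shows "nsr_le A x z"
  using assms add_assoc nsr_le_def by metis

lemma nsr_le_antisym:
  assumes "nsr_le A x y" "nsr_le A y x" "x \<in> carrier A" "y \<in> carrier A"
  shows "x = y"
  using assms add_comm nsr_le_def by metis

lemma nsr_le_add1: "x \<in> carrier A \<Longrightarrow> y \<in> carrier A \<Longrightarrow> nsr_le A x (x \<oplus> y)"
  by (simp add: nsr_le_def flip: add_assoc)

lemma nsr_le_add2: "x \<in> carrier A \<Longrightarrow> y \<in> carrier A \<Longrightarrow> nsr_le A y (x \<oplus> y)"
  using nsr_le_add1 add_comm by force

lemma nsr_le_add_lub:
  assumes "nsr_le A x z" "nsr_le A y z" "x \<in> carrier A" "y \<in> carrier A" "z \<in> carrier A"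
  shows "nsr_le A (x \<oplus> y) z"
  using assms by (simp add: nsr_le_def add_assoc)

lemma compatible_const: "c \<in> carrier A \<Longrightarrow> compatible A (\<lambda>_. c)"
  by (auto simp: compatible_def intro: nsr_congruenceD(5))

lemma compatible_add:
  "compatible A p \<Longrightarrow> compatible A q \<Longrightarrow> compatible A (\<lambda>x. p x \<oplus> q x)"
  by (auto simp: compatible_def intro: nsr_congruenceD(2))

lemma compatible_mult:
  "compatible A p \<Longrightarrow> compatible A q \<Longrightarrow> compatible A (\<lambda>x. p x \<otimes> q x)"
  by (auto simp: compatible_def intro: nsr_congruenceD(3))

lemma compatible_invol:
  "compatible A p \<Longrightarrow> compatible A (\<lambda>x. (p x)\<^sup>\<alpha>)"
  by (auto simp: compatible_def intro: nsr_congruenceD(4))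

lemma compatible_comp:
  "compatible A p \<Longrightarrow> compatible A q \<Longrightarrow> compatible A (\<lambda>x. p (q x))"
  by (simp add: compatible_def)

lemmas compatible_intros =
  compatible_id compatible_const compatible_add compatible_mult compatible_invol

lemma principal_congruence:
  assumes "a \<in> carrier A" "b \<in> carrier A"
  shows "nsr_congruence A (principal_congruence A a b)"
    and "(a, b) \<in> principal_congruence A a b"
proof -
  \<comment> \<open>An intersection over no congruence at all would be everything; the full relation
    rules this out and keeps the intersection inside the carrier.\<close>
  have full: "nsr_congruence A (carrier A \<times> carrier A)"
    by (rule nsr_congruenceI) auto
  then show "nsr_congruence A (principal_congruence A a b)"
    unfolding principal_congruence_def using assms
    by (intro nsr_congruenceI) (auto dest: nsr_congruenceD)
  show "(a, b) \<in> principal_congruence A a b"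
    by (simp add: principal_congruence_def)
qed

section \<open>Testing central elements at \<zero> and \<one>\<close>

lemma Ce_closed [simp]: "e \<in> Ce A \<Longrightarrow> e \<in> carrier A"
  by (simp add: Ce_def)

text \<open>Modulo \<open>principal_congruence A e \<zero>\<close>, \<open>p e\<close> is related to
  \<open>p \<zero> = q \<zero>\<close> and hence to \<open>q e\<close>. The same holds modulo the
  congruence of \<open>e\<close> and \<one>, and the two congruences meet only in the
  identity.\<close>

lemma Ce_eqI:
  assumes e: "e \<in> Ce A" and p: "compatible A p" and q: "compatible A q"
    and 0: "p \<zero> = q \<zero>" and 1: "p \<one> = q \<one>"
  shows "p e = q e"
proof -
  have eA: "e \<in> carrier A" using e by simp
  have pq: "(p e, q e) \<in> principal_congruence A e z"
    if z: "z \<in> carrier A" and "p z = q z" for z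
  proof -
    note c = principal_congruence[OF eA z]
    have "(p e, p z) \<in> principal_congruence A e z" "(q e, q z) \<in> principal_congruence A e z"
      using compatible_congruence[OF p c] compatible_congruence[OF q c] by auto
    then show ?thesis using nsr_congruenceD[OF c(1)] that by metis
  qed
  have "(p e, q e) \<in> principal_congruence A e \<zero> \<inter> principal_congruence A e \<one>"
    using pq[OF zero_closed 0] pq[OF one_closed 1] by (rule IntI)
  also have "\<dots> = Id_on (carrier A)"
    using e unfolding Ce_def factor_congruences_def by blast
  finally show ?thesis by (auto elim: Id_onE)
qed

text \<open>
  Conversely, the equations between compatible maps suffice for centrality: they make
  multiplication by \<open>e\<close> and by its complement complementary projections, whose kernels
  are the two principal congruences.
\<close>

lemma CeI:
  assumes eA [simp]: "e \<in> carrier A"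
    and eq: "\<And>p q. compatible A p \<Longrightarrow> compatible A q \<Longrightarrow> p \<zero> = q \<zero> \<Longrightarrow> p \<one> = q \<one> \<Longrightarrow> p e = q e"
  shows "e \<in> Ce A"
proof -
  define K where "K u = {(x, y) \<in> carrier A \<times> carrier A. u \<otimes> x = u \<otimes> y}" for u
  \<comment> \<open>A result multiplied by \<open>u\<close> depends only on the arguments multiplied
    by \<open>u\<close>, which makes \<open>K u\<close> a congruence. Each equation is trivial at
    \<zero> and \<one>.\<close>
  have proj: "u \<otimes> (x \<oplus> y) = u \<otimes> (u \<otimes> x \<oplus> u \<otimes> y)"
    "u \<otimes> (x \<otimes> y) = u \<otimes> ((u \<otimes> x) \<otimes> (u \<otimes> y))"
    "u \<otimes> x\<^sup>\<alpha> = u \<otimes> (u \<otimes> x)\<^sup>\<alpha>"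
    if "u = e \<or> u = e\<^sup>\<alpha>" and [simp]: "x \<in> carrier A" "y \<in> carrier A" for u x y
  proof -
    have "e \<otimes> (x \<oplus> y) = e \<otimes> (e \<otimes> x \<oplus> e \<otimes> y)"
      by (rule eq[of "\<lambda>e. e \<otimes> (x \<oplus> y)" "\<lambda>e. e \<otimes> (e \<otimes> x \<oplus> e \<otimes> y)"]) (simp_all add: compatible_intros)
    moreover have "e\<^sup>\<alpha> \<otimes> (x \<oplus> y) = e\<^sup>\<alpha> \<otimes> (e\<^sup>\<alpha> \<otimes> x \<oplus> e\<^sup>\<alpha> \<otimes> y)"
      by (rule eq[of "\<lambda>e. e\<^sup>\<alpha> \<otimes> (x \<oplus> y)" "\<lambda>e. e\<^sup>\<alpha> \<otimes> (e\<^sup>\<alpha> \<otimes> x \<oplus> e\<^sup>\<alpha> \<otimes> y)"]) (simp_all add: compatible_intros)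
    moreover have "e \<otimes> (x \<otimes> y) = e \<otimes> ((e \<otimes> x) \<otimes> (e \<otimes> y))"
      by (rule eq[of "\<lambda>e. e \<otimes> (x \<otimes> y)" "\<lambda>e. e \<otimes> ((e \<otimes> x) \<otimes> (e \<otimes> y))"]) (simp_all add: compatible_intros)
    moreover have "e\<^sup>\<alpha> \<otimes> (x \<otimes> y) = e\<^sup>\<alpha> \<otimes> ((e\<^sup>\<alpha> \<otimes> x) \<otimes> (e\<^sup>\<alpha> \<otimes> y))"
      by (rule eq[of "\<lambda>e. e\<^sup>\<alpha> \<otimes> (x \<otimes> y)" "\<lambda>e. e\<^sup>\<alpha> \<otimes> ((e\<^sup>\<alpha> \<otimes> x) \<otimes> (e\<^sup>\<alpha> \<otimes> y))"]) (simp_all add: compatible_intros)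
    moreover have "e \<otimes> x\<^sup>\<alpha> = e \<otimes> (e \<otimes> x)\<^sup>\<alpha>"
      by (rule eq[of "\<lambda>e. e \<otimes> x\<^sup>\<alpha>" "\<lambda>e. e \<otimes> (e \<otimes> x)\<^sup>\<alpha>"]) (simp_all add: compatible_intros)
    moreover have "e\<^sup>\<alpha> \<otimes> x\<^sup>\<alpha> = e\<^sup>\<alpha> \<otimes> (e\<^sup>\<alpha> \<otimes> x)\<^sup>\<alpha>"
      by (rule eq[of "\<lambda>e. e\<^sup>\<alpha> \<otimes> x\<^sup>\<alpha>" "\<lambda>e. e\<^sup>\<alpha> \<otimes> (e\<^sup>\<alpha> \<otimes> x)\<^sup>\<alpha>"]) (simp_all add: compatible_intros)
    ultimately show "u \<otimes> (x \<oplus> y) = u \<otimes> (u \<otimes> x \<oplus> u \<otimes> y)"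
      "u \<otimes> (x \<otimes> y) = u \<otimes> ((u \<otimes> x) \<otimes> (u \<otimes> y))"
      "u \<otimes> x\<^sup>\<alpha> = u \<otimes> (u \<otimes> x)\<^sup>\<alpha>"
      using that(1) by metis+
  qed
  have congr: "nsr_congruence A (K u)" if u: "u = e \<or> u = e\<^sup>\<alpha>" for u
  proof (rule nsr_congruenceI)
    have uA: "u \<in> carrier A" using u by auto
    fix x x' y y' assume "(x, x') \<in> K u" "(y, y') \<in> K u"
    then have "x \<in> carrier A" "x' \<in> carrier A" "y \<in> carrier A" "y' \<in> carrier A"
      "u \<otimes> x = u \<otimes> x'" "u \<otimes> y = u \<otimes> y'" by (auto simp: K_def)
    then show "(x \<oplus> y, x' \<oplus> y') \<in> K u" "(x \<otimes> y, x' \<otimes> y') \<in> K u"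
      using proj(1,2)[OF u, of x y] proj(1,2)[OF u, of x' y'] uA by (simp_all add: K_def)
  next
    have uA: "u \<in> carrier A" using u by auto
    fix x x' assume "(x, x') \<in> K u"
    then have "x \<in> carrier A" "x' \<in> carrier A" "u \<otimes> x = u \<otimes> x'" by (auto simp: K_def)
    then show "(x\<^sup>\<alpha>, x'\<^sup>\<alpha>) \<in> K u"
      using proj(3)[OF u, of x x] proj(3)[OF u, of x' x'] uA by (simp add: K_def)
  qed (auto simp: K_def)
  have ee: "e \<otimes> e = e"
    by (rule eq[of "\<lambda>e. e \<otimes> e" "\<lambda>e. e"]) (simp_all add: compatible_intros)
  have e'e: "e\<^sup>\<alpha> \<otimes> e = \<zero>"
    by (rule eq[of "\<lambda>e. e\<^sup>\<alpha> \<otimes> e" "\<lambda>e. \<zero>"]) (simp_all add: compatible_intros)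
  \<comment> \<open>Used for \<open>u = e\<^sup>\<alpha>\<close>, \<open>z = \<zero>\<close> and for
    \<open>u = e\<close>, \<open>z = \<one>\<close>. A congruence relating \<open>e\<close> to
    \<open>z\<close> relates \<open>u\<close> to \<one>, hence \<open>x = \<one> \<otimes> x\<close>
    to \<open>u \<otimes> x = u \<otimes> y\<close> and this to \<open>y\<close>.\<close>
  have kernel: "principal_congruence A e z = K u"
    if u: "u = e \<or> u = e\<^sup>\<alpha>" and z: "z \<in> carrier A" and ez: "u \<otimes> e = u \<otimes> z"
      and u1: "\<And>\<theta>. nsr_congruence A \<theta> \<Longrightarrow> (e, z) \<in> \<theta> \<Longrightarrow> (u, \<one>) \<in> \<theta>" for u z
  proof
    show "principal_congruence A e z \<subseteq> K u"
      unfolding principal_congruence_def using congr[OF u] z ez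
      by (intro Inter_lower) (auto simp: K_def)
    show "K u \<subseteq> principal_congruence A e z"
    proof (clarsimp simp: principal_congruence_def)
      fix x y \<theta> assume xy: "(x, y) \<in> K u" and t: "nsr_congruence A \<theta>" "(e, z) \<in> \<theta>"
      have [simp]: "x \<in> carrier A" "y \<in> carrier A" and "u \<otimes> x = u \<otimes> y"
        using xy by (auto simp: K_def)
      moreover have "(u \<otimes> x, \<one> \<otimes> x) \<in> \<theta>" "(u \<otimes> y, \<one> \<otimes> y) \<in> \<theta>"
        by (intro nsr_congruenceD(3,5)[OF t(1)] u1[OF t]; simp)+
      ultimately show "(x, y) \<in> \<theta>"
        using nsr_congruenceD(6,7)[OF t(1)] by (metis mult_one_left)
    qed
  qed
  have K0: "principal_congruence A e \<zero> = K (e\<^sup>\<alpha>)"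
  proof (rule kernel)
    show "(e\<^sup>\<alpha>, \<one>) \<in> \<theta>" if "nsr_congruence A \<theta>" "(e, \<zero>) \<in> \<theta>" for \<theta>
      using nsr_congruenceD(4)[OF that] by simp
  qed (auto simp: e'e)
  have K1: "principal_congruence A e \<one> = K e"
    by (rule kernel) (auto simp: ee)
  \<comment> \<open>An element is recovered from its two products, so the kernels intersect in the
    identity.\<close>
  have split: "x = e \<otimes> x \<oplus> e\<^sup>\<alpha> \<otimes> x" if [simp]: "x \<in> carrier A" for x
    by (rule eq[of "\<lambda>e. x" "\<lambda>e. e \<otimes> x \<oplus> e\<^sup>\<alpha> \<otimes> x"]) (simp_all add: compatible_intros)
  have "K (e\<^sup>\<alpha>) \<inter> K e = Id_on (carrier A)"
  proof (intro equalityI subrelI)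
    fix x y assume "(x, y) \<in> K (e\<^sup>\<alpha>) \<inter> K e"
    then show "(x, y) \<in> Id_on (carrier A)"
      using split[of x] split[of y] by (auto simp: K_def)
  qed (auto simp: K_def)
  moreover have "K (e\<^sup>\<alpha>) O K e = carrier A \<times> carrier A"
  proof (intro equalityI subrelI)
    fix x y assume "(x, y) \<in> carrier A \<times> carrier A"
    then have [simp]: "x \<in> carrier A" "y \<in> carrier A" by auto
    \<comment> \<open>Sharing one component with \<open>x\<close> and the other with
      \<open>y\<close>, this element links them through the two kernels.\<close>
    define z where "z = e\<^sup>\<alpha> \<otimes> x \<oplus> e \<otimes> y"
    have "e\<^sup>\<alpha> \<otimes> x = e\<^sup>\<alpha> \<otimes> z" "e \<otimes> z = e \<otimes> y"
      unfolding z_def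
       apply (rule eq[of "\<lambda>e. e\<^sup>\<alpha> \<otimes> x" "\<lambda>e. e\<^sup>\<alpha> \<otimes> (e\<^sup>\<alpha> \<otimes> x \<oplus> e \<otimes> y)"])
          apply (simp_all add: compatible_intros)
      apply (rule eq[of "\<lambda>e. e \<otimes> (e\<^sup>\<alpha> \<otimes> x \<oplus> e \<otimes> y)" "\<lambda>e. e \<otimes> y"])
         apply (simp_all add: compatible_intros)
      done
    then show "(x, y) \<in> K (e\<^sup>\<alpha>) O K e"
      by (intro relcompI[of _ z]) (auto simp: K_def z_def)
  qed (auto simp: K_def)
  ultimately show ?thesis
    unfolding Ce_def factor_congruences_def mem_Collect_eq K0 K1 using congr eA by blast
qed

section \<open>Boolean operations and projections of central elements\<close>

lemma Ce_invol: assumes e: "e \<in> Ce A" shows "e\<^sup>\<alpha> \<in> Ce A"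
proof (rule CeI)
  fix p q assume pq: "compatible A p" "compatible A q" "p \<zero> = q \<zero>" "p \<one> = q \<one>"
  show "p (e\<^sup>\<alpha>) = q (e\<^sup>\<alpha>)"
    using Ce_eqI[OF e compatible_comp[OF pq(1)] compatible_comp[OF pq(2)],
        of "\<lambda>x. x\<^sup>\<alpha>" "\<lambda>x. x\<^sup>\<alpha>"] pq
    by (simp add: compatible_intros)
qed (use e in simp)

text \<open>Vary \<open>e\<close> and keep \<open>f\<close> fixed: at \<zero> the test reads
  \<open>p \<zero> = q \<zero>\<close>, at \<one> it reads \<open>p f = q f\<close>, which holds
  because \<open>f\<close> is central.\<close>

lemma Ce_mult: assumes e: "e \<in> Ce A" and f: "f \<in> Ce A" shows "e \<otimes> f \<in> Ce A"
proof (rule CeI)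
  fix p q assume pq: "compatible A p" "compatible A q" "p \<zero> = q \<zero>" "p \<one> = q \<one>"
  have "p f = q f" using Ce_eqI[OF f] pq by blast
  then show "p (e \<otimes> f) = q (e \<otimes> f)"
    using Ce_eqI[OF e compatible_comp[OF pq(1)] compatible_comp[OF pq(2)],
        of "\<lambda>x. x \<otimes> f" "\<lambda>x. x \<otimes> f"] pq f
    by (simp add: compatible_intros)
qed (use e f in simp)

lemma Ce_add: assumes e: "e \<in> Ce A" and f: "f \<in> Ce A" shows "e \<oplus> f \<in> Ce A"
proof (rule CeI)
  fix p q assume pq: "compatible A p" "compatible A q" "p \<zero> = q \<zero>" "p \<one> = q \<one>"
  have "p f = q f" using Ce_eqI[OF f] pq by blast
  then show "p (e \<oplus> f) = q (e \<oplus> f)"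
    using Ce_eqI[OF e compatible_comp[OF pq(1)] compatible_comp[OF pq(2)],
        of "\<lambda>x. x \<oplus> f" "\<lambda>x. x \<oplus> f"] pq f
    by (simp add: compatible_intros)
qed (use e f in simp)

lemma Ce_mult_self: assumes e: "e \<in> Ce A" shows "e \<otimes> e = e"
  by (rule Ce_eqI[OF e, of "\<lambda>e. e \<otimes> e" "\<lambda>e. e"]) (simp_all add: compatible_intros)

lemma Ce_split:
  assumes e: "e \<in> Ce A" and x: "x \<in> carrier A"
  shows "e \<otimes> x \<oplus> e\<^sup>\<alpha> \<otimes> x = x"
  by (rule Ce_eqI[OF e, of "\<lambda>e. e \<otimes> x \<oplus> e\<^sup>\<alpha> \<otimes> x" "\<lambda>e. x"])
    (use x in \<open>simp_all add: compatible_intros\<close>)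

lemma Ce_ext:
  assumes "e \<in> Ce A" "x \<in> carrier A" "y \<in> carrier A"
    and "e \<otimes> x = e \<otimes> y" "e\<^sup>\<alpha> \<otimes> x = e\<^sup>\<alpha> \<otimes> y"
  shows "x = y"
  using assms Ce_split by metis

text \<open>The outer factor \<open>e\<close> is the one built into the operations of
  \<open>[0,e]\<close>, so these equations make multiplication by \<open>e\<close> a homomorphism
  from \<open>A\<close> to that interval; \<open>Ce_hom_invol\<close> covers the involution.\<close>

lemma Ce_hom:
  assumes e: "e \<in> Ce A" and [simp]: "x \<in> carrier A" "y \<in> carrier A"
  shows "e \<otimes> (e \<otimes> x \<oplus> e \<otimes> y) = e \<otimes> (x \<oplus> y)"
    and "e \<otimes> ((e \<otimes> x) \<otimes> (e \<otimes> y)) = e \<otimes> (x \<otimes> y)"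
   apply (rule Ce_eqI[OF e, of "\<lambda>e. e \<otimes> (e \<otimes> x \<oplus> e \<otimes> y)" "\<lambda>e. e \<otimes> (x \<oplus> y)"];
      simp add: compatible_intros)
  apply (rule Ce_eqI[OF e, of "\<lambda>e. e \<otimes> ((e \<otimes> x) \<otimes> (e \<otimes> y))" "\<lambda>e. e \<otimes> (x \<otimes> y)"];
      simp add: compatible_intros)
  done

lemma Ce_hom_invol:
  assumes e: "e \<in> Ce A" and [simp]: "x \<in> carrier A"
  shows "e \<otimes> (e \<otimes> x)\<^sup>\<alpha> = e \<otimes> x\<^sup>\<alpha>"
  by (rule Ce_eqI[OF e, of "\<lambda>e. e \<otimes> (e \<otimes> x)\<^sup>\<alpha>" "\<lambda>e. e \<otimes> x\<^sup>\<alpha>"])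
    (simp_all add: compatible_intros)

text \<open>Components below \<open>e\<close> and below its complement can be prescribed
  independently. Together with \<open>Ce_ext\<close> this makes \<open>A\<close> the product of the
  two intervals.\<close>

lemma Ce_glue:
  assumes e: "e \<in> Ce A" and [simp]: "x \<in> carrier A" "y \<in> carrier A"
  shows "e \<otimes> (e \<otimes> x \<oplus> e\<^sup>\<alpha> \<otimes> y) = e \<otimes> x"
    and "e\<^sup>\<alpha> \<otimes> (e \<otimes> x \<oplus> e\<^sup>\<alpha> \<otimes> y) = e\<^sup>\<alpha> \<otimes> y"
   apply (rule Ce_eqI[OF e, of "\<lambda>e. e \<otimes> (e \<otimes> x \<oplus> e\<^sup>\<alpha> \<otimes> y)" "\<lambda>e. e \<otimes> x"];
      simp add: compatible_intros)
  apply (rule Ce_eqI[OF e, of "\<lambda>e. e\<^sup>\<alpha> \<otimes> (e \<otimes> x \<oplus> e\<^sup>\<alpha> \<otimes> y)" "\<lambda>e. e\<^sup>\<alpha> \<otimes> y"];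
      simp add: compatible_intros)
  done

lemma Ce_mult_le:
  assumes e: "e \<in> Ce A" and [simp]: "x \<in> carrier A"
  shows "nsr_le A (e \<otimes> x) e" and "nsr_le A (e \<otimes> x) x"
  unfolding nsr_le_def
   apply (rule Ce_eqI[OF e, of "\<lambda>e. e \<otimes> x \<oplus> e" "\<lambda>e. e"]; simp add: compatible_intros)
  apply (rule Ce_eqI[OF e, of "\<lambda>e. e \<otimes> x \<oplus> x" "\<lambda>e. x"]; simp add: compatible_intros)
  done

lemma le_Ce_iff:
  assumes e: "e \<in> Ce A" and x [simp]: "x \<in> carrier A"
  shows "nsr_le A x e \<longleftrightarrow> e \<otimes> x = x"
proof
  assume "nsr_le A x e"
  then have xe: "x \<oplus> e = e" by (simp add: nsr_le_def)
  \<comment> \<open>The hypothesis \<open>x \<oplus> e = e\<close> may fail once \<open>e\<close> is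
    replaced by \<zero>, so the test is applied to an identity free of it. Substituting it
    afterwards turns the second summand into
    \<open>e\<^sup>\<alpha> \<otimes> e = \<zero>\<close>.\<close>
  have "e \<otimes> x \<oplus> e\<^sup>\<alpha> \<otimes> (x \<oplus> e) = x"
    by (rule Ce_eqI[OF e, of "\<lambda>e. e \<otimes> x \<oplus> e\<^sup>\<alpha> \<otimes> (x \<oplus> e)" "\<lambda>e. x"])
      (simp_all add: compatible_intros)
  moreover have "e\<^sup>\<alpha> \<otimes> e = \<zero>"
    by (rule Ce_eqI[OF e, of "\<lambda>e. e\<^sup>\<alpha> \<otimes> e" "\<lambda>e. \<zero>"]) (simp_all add: compatible_intros)
  ultimately show "e \<otimes> x = x" using e xe by simp
next
  assume "e \<otimes> x = x"
  then show "nsr_le A x e" using Ce_mult_le[OF e x] by simp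
qed

text \<open>With \<open>Ce_mult_le\<close> this makes \<open>e \<otimes> y\<close> the meet of
  \<open>e\<close> and \<open>y\<close>.\<close>

lemma Ce_le_multI:
  assumes e: "e \<in> Ce A" and x [simp]: "x \<in> carrier A" and y [simp]: "y \<in> carrier A"
    and "nsr_le A x e" "nsr_le A x y"
  shows "nsr_le A x (e \<otimes> y)"
proof -
  \<comment> \<open>Left distributivity is not an axiom, but it holds for a central left
    factor.\<close>
  have "e \<otimes> x \<oplus> e \<otimes> y = e \<otimes> (x \<oplus> y)"
    by (rule Ce_eqI[OF e, of "\<lambda>e. e \<otimes> x \<oplus> e \<otimes> y" "\<lambda>e. e \<otimes> (x \<oplus> y)"])
      (simp_all add: compatible_intros)
  then show ?thesis using assms le_Ce_iff[OF e x] by (simp add: nsr_le_def)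
qed

end

section \<open>Interval algebras\<close>

lemma interval_algebra_simps [simp]:
  "carrier (interval_algebra A e) = {x \<in> carrier A. nsr_le A x e}"
  "x \<otimes>\<^bsub>interval_algebra A e\<^esub> y = e \<otimes>\<^bsub>A\<^esub> (x \<otimes>\<^bsub>A\<^esub> y)"
  "x \<oplus>\<^bsub>interval_algebra A e\<^esub> y = e \<otimes>\<^bsub>A\<^esub> (x \<oplus>\<^bsub>A\<^esub> y)"
  "x\<^sup>\<alpha>\<^bsub>interval_algebra A e\<^esub> = e \<otimes>\<^bsub>A\<^esub> x\<^sup>\<alpha>\<^bsub>A\<^esub>"
  "\<zero>\<^bsub>interval_algebra A e\<^esub> = \<zero>\<^bsub>A\<^esub>"
  "\<one>\<^bsub>interval_algebra A e\<^esub> = e"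
  by (simp_all add: interval_algebra_def)

context iota_near_semiring
begin

lemma nsr_le_interval_iff:
  assumes c: "c \<in> Ce A" and x: "x \<in> carrier A" "nsr_le A x c" and y: "y \<in> carrier A" "nsr_le A y c"
  shows "nsr_le (interval_algebra A c) x y \<longleftrightarrow> nsr_le A x y"
proof -
  have "nsr_le A (x \<oplus> y) c" using assms by (intro nsr_le_add_lub) auto
  then have "c \<otimes> (x \<oplus> y) = x \<oplus> y" using assms le_Ce_iff by simp
  then show ?thesis by (simp add: nsr_le_def)
qed

lemma iota_near_semiring_interval:
  assumes c: "c \<in> Ce A"
  shows "iota_near_semiring (interval_algebra A c)"
proof -
  let ?I = "interval_algebra A c"
  have I: "x \<in> carrier A \<and> nsr_le A x c \<and> c \<otimes> x = x" if "x \<in> carrier ?I" for x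
    using that le_Ce_iff[OF c] by auto
  have cI: "c \<otimes> x \<in> carrier ?I" if "x \<in> carrier A" for x
    using that Ce_mult_le[OF c] c by simp
  show ?thesis
  proof
    fix x y assume x: "x \<in> carrier ?I" and y: "y \<in> carrier ?I"
    note xy = I[OF x] I[OF y]
    show "x \<oplus>\<^bsub>?I\<^esub> y \<in> carrier ?I" "x \<otimes>\<^bsub>?I\<^esub> y \<in> carrier ?I"
      unfolding interval_algebra_simps(2,3) by (intro cI; use xy in simp)+
    show "x \<oplus>\<^bsub>?I\<^esub> y = y \<oplus>\<^bsub>?I\<^esub> x"
      using xy add_comm by simp
    assume "nsr_le ?I x y"
    then have "nsr_le A x y" using nsr_le_interval_iff[OF c] xy by blast
    then have le: "y\<^sup>\<alpha> \<oplus> x\<^sup>\<alpha> = x\<^sup>\<alpha>" using xy invol_antitone by (simp add: nsr_le_def)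
    have "c \<otimes> (c \<otimes> y\<^sup>\<alpha> \<oplus> c \<otimes> x\<^sup>\<alpha>) = c \<otimes> x\<^sup>\<alpha>"
      using Ce_hom(1)[OF c, of "y\<^sup>\<alpha>" "x\<^sup>\<alpha>"] xy le by simp
    then show "nsr_le ?I (y\<^sup>\<alpha>\<^bsub>?I\<^esub>) (x\<^sup>\<alpha>\<^bsub>?I\<^esub>)" by (simp add: nsr_le_def)
  next
    fix x assume x: "x \<in> carrier ?I"
    note X = I[OF x]
    then have [simp]: "x \<in> carrier A" "c \<in> carrier A" "c \<otimes> x = x" using c by auto
    show "x\<^sup>\<alpha>\<^bsub>?I\<^esub> \<in> carrier ?I"
      unfolding interval_algebra_simps(4) by (intro cI) simp
    show "x \<oplus>\<^bsub>?I\<^esub> x = x" "\<zero>\<^bsub>?I\<^esub> \<otimes>\<^bsub>?I\<^esub> x = \<zero>\<^bsub>?I\<^esub>" "x \<otimes>\<^bsub>?I\<^esub> \<zero>\<^bsub>?I\<^esub> = \<zero>\<^bsub>?I\<^esub>"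
      "nsr_le ?I (\<zero>\<^bsub>?I\<^esub>) x" "\<one>\<^bsub>?I\<^esub> \<otimes>\<^bsub>?I\<^esub> x = x"
      by (simp_all add: nsr_le_def)
    show "nsr_le ?I x (\<one>\<^bsub>?I\<^esub>)"
      using X Ce_mult_self[OF c] by (simp add: nsr_le_def)
    \<comment> \<open>\<open>c \<otimes> x\<close> stands for \<open>x\<close>, since
      \<open>x\<close> need not lie below the test value \<zero>.\<close>
    have "c \<otimes> ((c \<otimes> x) \<otimes> c) = c \<otimes> x"
      by (rule Ce_eqI[OF c, of "\<lambda>c. c \<otimes> ((c \<otimes> x) \<otimes> c)" "\<lambda>c. c \<otimes> x"])
        (simp_all add: compatible_intros)
    then show "x \<otimes>\<^bsub>?I\<^esub> \<one>\<^bsub>?I\<^esub> = x" by simp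
    show "(x\<^sup>\<alpha>\<^bsub>?I\<^esub>)\<^sup>\<alpha>\<^bsub>?I\<^esub> = x"
      using Ce_hom_invol[OF c, of "x\<^sup>\<alpha>"] by simp
  next
    fix x y z assume "x \<in> carrier ?I" "y \<in> carrier ?I" "z \<in> carrier ?I"
    then have [simp]: "x \<in> carrier A" "y \<in> carrier A" "z \<in> carrier A" by auto
    have "c \<otimes> (c \<otimes> (x \<oplus> y) \<oplus> z) = c \<otimes> (x \<oplus> c \<otimes> (y \<oplus> z))"
      by (rule Ce_eqI[OF c, of "\<lambda>c. c \<otimes> (c \<otimes> (x \<oplus> y) \<oplus> z)" "\<lambda>c. c \<otimes> (x \<oplus> c \<otimes> (y \<oplus> z))"])
        (simp_all add: compatible_intros add_assoc)
    then show "x \<oplus>\<^bsub>?I\<^esub> y \<oplus>\<^bsub>?I\<^esub> z = x \<oplus>\<^bsub>?I\<^esub> (y \<oplus>\<^bsub>?I\<^esub> z)" by simp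
    have "c \<otimes> (c \<otimes> (x \<oplus> y) \<otimes> z) = c \<otimes> (c \<otimes> (x \<otimes> z) \<oplus> c \<otimes> (y \<otimes> z))"
      by (rule Ce_eqI[OF c, of "\<lambda>c. c \<otimes> (c \<otimes> (x \<oplus> y) \<otimes> z)"
            "\<lambda>c. c \<otimes> (c \<otimes> (x \<otimes> z) \<oplus> c \<otimes> (y \<otimes> z))"])
        (simp_all add: compatible_intros right_distrib)
    then show "(x \<oplus>\<^bsub>?I\<^esub> y) \<otimes>\<^bsub>?I\<^esub> z = x \<otimes>\<^bsub>?I\<^esub> z \<oplus>\<^bsub>?I\<^esub> y \<otimes>\<^bsub>?I\<^esub> z" by simp
  qed (use c nsr_le_def in \<open>auto simp: nsr_le_def\<close>)
qed

section \<open>The centre of an interval algebra\<close>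

text \<open>Pulling congruences back along a homomorphism lets compatible maps be carried between
  algebras. It is applied to the projection onto an interval and to inverse isomorphisms.\<close>

lemma nsr_congruence_vimage:
  assumes "\<And>x. x \<in> carrier A \<Longrightarrow> k x \<in> carrier B"
    and "\<And>x y. x \<in> carrier A \<Longrightarrow> y \<in> carrier A \<Longrightarrow> k (x \<oplus> y) = k x \<oplus>\<^bsub>B\<^esub> k y"
    and "\<And>x y. x \<in> carrier A \<Longrightarrow> y \<in> carrier A \<Longrightarrow> k (x \<otimes> y) = k x \<otimes>\<^bsub>B\<^esub> k y"
    and "\<And>x. x \<in> carrier A \<Longrightarrow> k (x\<^sup>\<alpha>) = (k x)\<^sup>\<alpha>\<^bsub>B\<^esub>"
    and "nsr_congruence B \<theta>"
  shows "nsr_congruence A {(x, y) \<in> carrier A \<times> carrier A. (k x, k y) \<in> \<theta>}"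
proof -
  note D = nsr_congruenceD[OF assms(5)]
  show ?thesis
    by (rule nsr_congruenceI)
      (auto simp: assms(1-4) intro: D(2-5), (blast intro: D(6,7))+)
qed

text \<open>The interval operations end with a multiplication by \<open>c\<close>, and
  \<open>c\<close> is related to itself.\<close>

lemma nsr_congruence_restrict:
  assumes c: "c \<in> Ce A" and "nsr_congruence A \<theta>"
  shows "nsr_congruence (interval_algebra A c)
    (\<theta> \<inter> carrier (interval_algebra A c) \<times> carrier (interval_algebra A c))"
proof (rule nsr_congruenceI)
  let ?I = "interval_algebra A c"
  note D = nsr_congruenceD[OF assms(2)]
  have cI: "c \<otimes> x \<in> carrier ?I" if "x \<in> carrier A" for x
    using that Ce_mult_le[OF c] c by simp
  have cc: "(c, c) \<in> \<theta>" using c by (intro D(5)) simp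
  fix x x' assume "(x, x') \<in> \<theta> \<inter> carrier ?I \<times> carrier ?I"
  then have x: "(x, x') \<in> \<theta>" "x \<in> carrier A" "x' \<in> carrier A" by auto
  show "(x\<^sup>\<alpha>\<^bsub>?I\<^esub>, x'\<^sup>\<alpha>\<^bsub>?I\<^esub>) \<in> \<theta> \<inter> carrier ?I \<times> carrier ?I"
    unfolding interval_algebra_simps(4)
    by (intro IntI SigmaI cI D(3)[OF cc] D(4)) (use x in auto)
  fix y y' assume "(y, y') \<in> \<theta> \<inter> carrier ?I \<times> carrier ?I"
  then have y: "(y, y') \<in> \<theta>" "y \<in> carrier A" "y' \<in> carrier A" by auto
  show "(x \<oplus>\<^bsub>?I\<^esub> y, x' \<oplus>\<^bsub>?I\<^esub> y') \<in> \<theta> \<inter> carrier ?I \<times> carrier ?I"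
    unfolding interval_algebra_simps(3)
    by (intro IntI SigmaI cI D(3)[OF cc] D(2)) (use x y in auto)
  show "(x \<otimes>\<^bsub>?I\<^esub> y, x' \<otimes>\<^bsub>?I\<^esub> y') \<in> \<theta> \<inter> carrier ?I \<times> carrier ?I"
    unfolding interval_algebra_simps(2)
    by (intro IntI SigmaI cI D(3)[OF cc] D(3)) (use x y in auto)
qed (auto intro: nsr_congruenceD(5)[OF assms(2)],
    (blast intro: nsr_congruenceD(6,7)[OF assms(2)])+)

text \<open>Test maps are moved both ways. Those of \<open>[0,c]\<close> are preceded by
  multiplication by \<open>c\<close>; those of \<open>A\<close> are followed by it, and the
  component below \<open>c\<^sup>\<alpha>\<close> lost in this way is compared separately.\<close>

lemma Ce_interval:
  assumes c: "c \<in> Ce A"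
  shows "Ce (interval_algebra A c) = {e \<in> Ce A. nsr_le A e c}"
proof -
  let ?I = "interval_algebra A c"
  interpret I: iota_near_semiring ?I
    by (rule iota_near_semiring_interval[OF c])
  have cI: "c \<otimes> x \<in> carrier ?I" if "x \<in> carrier A" for x
    using that Ce_mult_le[OF c] c by simp
  show ?thesis
  proof (intro equalityI subsetI)
    fix e assume "e \<in> {e \<in> Ce A. nsr_le A e c}"
    then have e: "e \<in> Ce A" "nsr_le A e c" and ce: "c \<otimes> e = e"
      using le_Ce_iff[OF c] by auto
    show "e \<in> Ce ?I"
    proof (rule I.CeI)
      fix p q assume p: "compatible ?I p" and q: "compatible ?I q"
        and 0: "p \<zero>\<^bsub>?I\<^esub> = q \<zero>\<^bsub>?I\<^esub>" and 1: "p \<one>\<^bsub>?I\<^esub> = q \<one>\<^bsub>?I\<^esub>"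
      have compat: "compatible A (\<lambda>x. r (c \<otimes> x))" if r: "compatible ?I r" for r
        unfolding compatible_def
      proof (intro conjI ballI allI impI)
        fix x assume "x \<in> carrier A"
        then show "r (c \<otimes> x) \<in> carrier A"
          using compatible_closed[OF r cI] by auto
      next
        fix \<theta> x y assume t: "nsr_congruence A \<theta>" and xy: "(x, y) \<in> \<theta>"
        have "(c \<otimes> x, c \<otimes> y) \<in> \<theta>"
          using nsr_congruenceD(3,5)[OF t] xy c by simp
        moreover have "x \<in> carrier A" "y \<in> carrier A"
          using nsr_congruenceD(8)[OF t xy] by auto
        ultimately show "(r (c \<otimes> x), r (c \<otimes> y)) \<in> \<theta>"
          using compatible_congruence[OF r nsr_congruence_restrict[OF c t]] cI by blast
      qed
      \<comment> \<open>At \<zero> and \<one> the composed maps evaluate \<open>p\<close> and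
        \<open>q\<close> at \<zero> and \<open>c\<close>, the constants of the interval.\<close>
      have "p (c \<otimes> e) = q (c \<otimes> e)"
        by (rule Ce_eqI[OF e(1), of "\<lambda>e. p (c \<otimes> e)" "\<lambda>e. q (c \<otimes> e)"])
          (use p q 0 1 c compat in simp_all)
      then show "p e = q e" by (simp add: ce)
    qed (use e in simp)
  next
    fix e assume eI: "e \<in> Ce ?I"
    then have e: "e \<in> carrier A" "nsr_le A e c" using I.Ce_closed by auto
    then have ce: "c \<otimes> e = e" using le_Ce_iff[OF c] by auto
    have "e \<in> Ce A"
    proof (rule CeI)
      fix p q assume p: "compatible A p" and q: "compatible A q"
        and 0: "p \<zero> = q \<zero>" and 1: "p \<one> = q \<one>"
      have compat: "compatible ?I (\<lambda>x. c \<otimes> r x)" if r: "compatible A r" for r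
        unfolding compatible_def
      proof (intro conjI ballI allI impI)
        fix x assume "x \<in> carrier ?I"
        then show "c \<otimes> r x \<in> carrier ?I"
          using compatible_closed[OF r] cI by auto
      next
        fix \<theta> x y assume t: "nsr_congruence ?I \<theta>" and xy: "(x, y) \<in> \<theta>"
        have t': "nsr_congruence A {(x, y) \<in> carrier A \<times> carrier A. (c \<otimes> x, c \<otimes> y) \<in> \<theta>}"
          by (rule nsr_congruence_vimage[OF _ _ _ _ t]) (use c cI Ce_hom[OF c] Ce_hom_invol[OF c] in auto)
        have "(x, y) \<in> {(x, y) \<in> carrier A \<times> carrier A. (c \<otimes> x, c \<otimes> y) \<in> \<theta>}"
          using nsr_congruenceD(8)[OF t xy] le_Ce_iff[OF c] xy by auto
        from compatible_congruence[OF r t' this] show "(c \<otimes> r x, c \<otimes> r y) \<in> \<theta>" by simp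
      qed
      \<comment> \<open>The first equation lets the unit \<open>c\<close> of the interval stand for
        \<one>. By the second, as \<open>e = c \<otimes> e\<close>, the component of
        \<open>r e\<close> below \<open>c\<^sup>\<alpha>\<close> is that of
        \<open>r \<zero>\<close>.\<close>
      have r: "c \<otimes> r c = c \<otimes> r \<one>" "c\<^sup>\<alpha> \<otimes> r (c \<otimes> e) = c\<^sup>\<alpha> \<otimes> r \<zero>"
        if "compatible A r" for r
         apply (rule Ce_eqI[OF c, of "\<lambda>c. c \<otimes> r c" "\<lambda>c. c \<otimes> r \<one>"];
            simp add: that e compatible_intros compatible_closed)
        apply (rule Ce_eqI[OF c, of "\<lambda>c. c\<^sup>\<alpha> \<otimes> r (c \<otimes> e)" "\<lambda>c. c\<^sup>\<alpha> \<otimes> r \<zero>"];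
            simp add: that e compatible_intros compatible_closed
              compatible_comp[OF that, of "\<lambda>c. c \<otimes> e"])
        done
      have "c \<otimes> p e = c \<otimes> q e"
        by (rule I.Ce_eqI[OF eI, of "\<lambda>e. c \<otimes> p e" "\<lambda>e. c \<otimes> q e"])
          (use p q 0 1 r compat in simp_all)
      moreover have "c\<^sup>\<alpha> \<otimes> p e = c\<^sup>\<alpha> \<otimes> q e"
        using r(2)[OF p] r(2)[OF q] ce 0 by simp
      ultimately show "p e = q e"
        using Ce_ext[OF c] compatible_closed e p q by metis
    qed (rule e)
    then show "e \<in> {e \<in> Ce A. nsr_le A e c}" using e by simp
  qed
qed

end

section \<open>Isomorphisms and their action on intervals and centres\<close>

lemma nsr_isoI:
  assumes "bij_betw h (carrier A) (carrier B)"
    and "\<And>x y. x \<in> carrier A \<Longrightarrow> y \<in> carrier A \<Longrightarrow> h (x \<oplus>\<^bsub>A\<^esub> y) = h x \<oplus>\<^bsub>B\<^esub> h y"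
    and "\<And>x y. x \<in> carrier A \<Longrightarrow> y \<in> carrier A \<Longrightarrow> h (x \<otimes>\<^bsub>A\<^esub> y) = h x \<otimes>\<^bsub>B\<^esub> h y"
    and "\<And>x. x \<in> carrier A \<Longrightarrow> h (x\<^sup>\<alpha>\<^bsub>A\<^esub>) = (h x)\<^sup>\<alpha>\<^bsub>B\<^esub>"
    and "h \<zero>\<^bsub>A\<^esub> = \<zero>\<^bsub>B\<^esub>" "h \<one>\<^bsub>A\<^esub> = \<one>\<^bsub>B\<^esub>"
  shows "h \<in> nsr_iso A B"
  using assms by (simp add: nsr_iso_def)

lemma nsr_isoD:
  assumes "h \<in> nsr_iso A B"
  shows "bij_betw h (carrier A) (carrier B)"
    and "\<And>x y. x \<in> carrier A \<Longrightarrow> y \<in> carrier A \<Longrightarrow> h (x \<oplus>\<^bsub>A\<^esub> y) = h x \<oplus>\<^bsub>B\<^esub> h y"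
    and "\<And>x y. x \<in> carrier A \<Longrightarrow> y \<in> carrier A \<Longrightarrow> h (x \<otimes>\<^bsub>A\<^esub> y) = h x \<otimes>\<^bsub>B\<^esub> h y"
    and "\<And>x. x \<in> carrier A \<Longrightarrow> h (x\<^sup>\<alpha>\<^bsub>A\<^esub>) = (h x)\<^sup>\<alpha>\<^bsub>B\<^esub>"
    and "h \<zero>\<^bsub>A\<^esub> = \<zero>\<^bsub>B\<^esub>" "h \<one>\<^bsub>A\<^esub> = \<one>\<^bsub>B\<^esub>"
    and "\<And>x. x \<in> carrier A \<Longrightarrow> h x \<in> carrier B"
    and "inj_on h (carrier A)" "h ` carrier A = carrier B"
  using assms by (auto simp: nsr_iso_def bij_betw_def)

lemma nsr_iso_comp:
  assumes g: "g \<in> nsr_iso A B" and h: "h \<in> nsr_iso B C"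
  shows "h \<circ> g \<in> nsr_iso A C"
  by (rule nsr_isoI) (use nsr_isoD(1)[OF g] nsr_isoD(1)[OF h] nsr_isoD(2-7)[OF g]
      nsr_isoD(2-6)[OF h] in \<open>auto intro: bij_betw_trans\<close>)

lemma nsr_isomorphic_trans [trans]:
  "nsr_isomorphic A B \<Longrightarrow> nsr_isomorphic B C \<Longrightarrow> nsr_isomorphic A C"
  unfolding nsr_isomorphic_def using nsr_iso_comp by blast

lemma (in iota_near_semiring) nsr_iso_inv_into:
  assumes h: "h \<in> nsr_iso A B"
  shows "inv_into (carrier A) h \<in> nsr_iso B A"
proof -
  let ?g = "inv_into (carrier A) h"
  note D = nsr_isoD[OF h]
  have gx: "?g (h x) = x" if "x \<in> carrier A" for x
    using D(8) that by simp
  have ex: "\<exists>x\<in>carrier A. y = h x" if "y \<in> carrier B" for y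
    using D(9) that by blast
  show ?thesis
  proof (rule nsr_isoI)
    show "bij_betw ?g (carrier B) (carrier A)" using D(1) by (rule bij_betw_inv_into)
    show "?g \<zero>\<^bsub>B\<^esub> = \<zero>" "?g \<one>\<^bsub>B\<^esub> = \<one>"
      using gx[OF zero_closed] gx[OF one_closed] D(5,6) by auto
    fix u assume "u \<in> carrier B"
    then obtain x where x: "x \<in> carrier A" "u = h x" using ex by blast
    show "?g (u\<^sup>\<alpha>\<^bsub>B\<^esub>) = (?g u)\<^sup>\<alpha>"
      using x gx[of x] gx[of "x\<^sup>\<alpha>"] D(4)[of x] by simp
    fix v assume "v \<in> carrier B"
    then obtain y where y: "y \<in> carrier A" "v = h y" using ex by blast
    show "?g (u \<oplus>\<^bsub>B\<^esub> v) = ?g u \<oplus> ?g v" "?g (u \<otimes>\<^bsub>B\<^esub> v) = ?g u \<otimes> ?g v"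
      using x y gx[of x] gx[of y] gx[of "x \<oplus> y"] gx[of "x \<otimes> y"] D(2,3)[of x y] by simp_all
  qed
qed

lemma (in iota_near_semiring) nsr_isomorphic_sym:
  "nsr_isomorphic A B \<Longrightarrow> nsr_isomorphic B A"
  unfolding nsr_isomorphic_def using nsr_iso_inv_into by blast

lemma (in iota_near_semiring) nsr_iso_le_iff:
  assumes h: "h \<in> nsr_iso A B" and "x \<in> carrier A" "y \<in> carrier A"
  shows "nsr_le B (h x) (h y) \<longleftrightarrow> nsr_le A x y"
  using nsr_isoD(2)[OF h, of x y] nsr_isoD(8)[OF h] assms
  by (auto simp: nsr_le_def inj_on_def)

lemma (in iota_near_semiring) nsr_iso_interval:
  assumes h: "h \<in> nsr_iso A B" and e: "e \<in> carrier A"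
  shows "h \<in> nsr_iso (interval_algebra A e) (interval_algebra B (h e))"
proof (rule nsr_isoI)
  show "bij_betw h (carrier (interval_algebra A e)) (carrier (interval_algebra B (h e)))"
    unfolding bij_betw_def
  proof
    show "inj_on h (carrier (interval_algebra A e))"
      using nsr_isoD(8)[OF h] by (rule inj_on_subset) auto
    show "h ` carrier (interval_algebra A e) = carrier (interval_algebra B (h e))"
      unfolding interval_algebra_simps(1) nsr_isoD(9)[OF h, symmetric]
      using nsr_iso_le_iff[OF h _ e] by auto
  qed
qed (use e nsr_isoD(2-6)[OF h] in auto)

text \<open>Conjugation by \<open>h\<close> turns test maps of \<open>B\<close> into test maps of
  \<open>A\<close>, with \<zero> and \<one> corresponding.\<close>

lemma nsr_iso_Ce:
  assumes A: "iota_near_semiring A" and B: "iota_near_semiring B"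
    and h: "h \<in> nsr_iso A B" and e: "e \<in> Ce A"
  shows "h e \<in> Ce B"
proof -
  interpret A: iota_near_semiring A by (rule A)
  interpret B: iota_near_semiring B by (rule B)
  let ?g = "inv_into (carrier A) h"
  note D = nsr_isoD[OF h]
  have g: "?g \<in> nsr_iso B A" by (rule A.nsr_iso_inv_into[OF h])
  note G = nsr_isoD[OF g]
  have gh: "?g (h x) = x" if "x \<in> carrier A" for x
    using D(8) that by simp
  have compat: "compatible A (\<lambda>x. ?g (p (h x)))" if p: "compatible B p" for p
    unfolding compatible_def
  proof (intro conjI ballI allI impI)
    fix x assume "x \<in> carrier A"
    then show "?g (p (h x)) \<in> carrier A"
      using D(7) G(7) compatible_closed[OF p] by blast
  next
    fix \<theta> x y assume t: "nsr_congruence A \<theta>" and xy: "(x, y) \<in> \<theta>"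
    have t': "nsr_congruence B {(x, y) \<in> carrier B \<times> carrier B. (?g x, ?g y) \<in> \<theta>}"
      by (rule B.nsr_congruence_vimage[OF _ _ _ _ t]) (use G(2-4,7) in auto)
    have "(h x, h y) \<in> {(x, y) \<in> carrier B \<times> carrier B. (?g x, ?g y) \<in> \<theta>}"
      using nsr_congruenceD(8)[OF t xy] D(7) gh xy by auto
    from compatible_congruence[OF p t' this] show "(?g (p (h x)), ?g (p (h y))) \<in> \<theta>" by simp
  qed
  show ?thesis
  proof (rule B.CeI)
    show he: "h e \<in> carrier B" using e D(7) by simp
    fix p q assume p: "compatible B p" and q: "compatible B q"
      and 0: "p \<zero>\<^bsub>B\<^esub> = q \<zero>\<^bsub>B\<^esub>" and 1: "p \<one>\<^bsub>B\<^esub> = q \<one>\<^bsub>B\<^esub>"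
    have "?g (p (h e)) = ?g (q (h e))"
      by (rule A.Ce_eqI[OF e compat[OF p] compat[OF q]]) (simp_all add: D(5,6) 0 1)
    then show "p (h e) = q (h e)"
      using G(8) compatible_closed[OF p he] compatible_closed[OF q he] by (auto dest: inj_onD)
  qed
qed

text \<open>Both algebras have the same carrier. The nested operations carry extra factors
  \<open>c\<close>, which \<open>key\<close> absorbs.\<close>

lemma (in iota_near_semiring) interval_interval_iso:
  assumes c: "c \<in> Ce A" and e: "e \<in> carrier A" "nsr_le A e c"
  shows "id \<in> nsr_iso (interval_algebra (interval_algebra A c) e) (interval_algebra A e)"
proof -
  have ce: "c \<otimes> e = e" using e le_Ce_iff[OF c] by simp
  have key: "c \<otimes> (e \<otimes> (c \<otimes> z)) = e \<otimes> z" if z: "z \<in> carrier A" for z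
  proof -
    \<comment> \<open>Writing \<open>e\<close> as \<open>c \<otimes> e\<close> leaves an identity in
      \<open>c\<close> that holds for every \<open>e\<close>.\<close>
    have "c \<otimes> ((c \<otimes> e) \<otimes> (c \<otimes> z)) = (c \<otimes> e) \<otimes> z"
      by (rule Ce_eqI[OF c, of "\<lambda>c. c \<otimes> ((c \<otimes> e) \<otimes> (c \<otimes> z))" "\<lambda>c. (c \<otimes> e) \<otimes> z"])
        (use e z in \<open>simp_all add: compatible_intros\<close>)
    then show ?thesis by (simp add: ce)
  qed
  have "carrier (interval_algebra (interval_algebra A c) e) = carrier (interval_algebra A e)"
    using nsr_le_interval_iff[OF c _ _ e] nsr_le_trans[OF _ e(2)] c e by auto
  then show ?thesis by (intro nsr_isoI) (simp_all add: key)
qed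

section \<open>Gluing along central decompositions\<close>

lemma nsr_isomorphic_glue:
  assumes A: "iota_near_semiring A" and D: "iota_near_semiring D"
    and e: "e \<in> Ce A" and u: "u \<in> Ce D"
    and iso1: "nsr_isomorphic (interval_algebra A e) (interval_algebra D u)"
    and iso2: "nsr_isomorphic (interval_algebra A (e\<^sup>\<alpha>\<^bsub>A\<^esub>)) (interval_algebra D (u\<^sup>\<alpha>\<^bsub>D\<^esub>))"
  shows "nsr_isomorphic A D"
proof -
  interpret A: iota_near_semiring A by (rule A)
  interpret D: iota_near_semiring D by (rule D)
  define e' where "e' = e\<^sup>\<alpha>\<^bsub>A\<^esub>"
  define u' where "u' = u\<^sup>\<alpha>\<^bsub>D\<^esub>"
  have e': "e' \<in> Ce A" and u': "u' \<in> Ce D"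
    using A.Ce_invol[OF e] D.Ce_invol[OF u] by (simp_all add: e'_def u'_def)
  obtain h1 where h1: "h1 \<in> nsr_iso (interval_algebra A e) (interval_algebra D u)"
    using iso1 by (auto simp: nsr_isomorphic_def)
  obtain h2 where h2: "h2 \<in> nsr_iso (interval_algebra A e') (interval_algebra D u')"
    using iso2 by (auto simp: nsr_isomorphic_def e'_def u'_def)
  \<comment> \<open>The product map: each component is sent through its own isomorphism, and the
    images, lying below \<open>u\<close> and \<open>u'\<close>, are added.\<close>
  define \<phi> where "\<phi> x = h1 (e \<otimes>\<^bsub>A\<^esub> x) \<oplus>\<^bsub>D\<^esub> h2 (e' \<otimes>\<^bsub>A\<^esub> x)" for x
  have proj_in: "v \<otimes>\<^bsub>A\<^esub> x \<in> carrier (interval_algebra A v)" if "v \<in> Ce A" "x \<in> carrier A" for v x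
    using that A.Ce_mult_le by simp
  have iso_in: "h (v \<otimes>\<^bsub>A\<^esub> x) \<in> carrier D \<and> w \<otimes>\<^bsub>D\<^esub> h (v \<otimes>\<^bsub>A\<^esub> x) = h (v \<otimes>\<^bsub>A\<^esub> x)"
    if "h \<in> nsr_iso (interval_algebra A v) (interval_algebra D w)" "v \<in> Ce A" "w \<in> Ce D"
      "x \<in> carrier A" for h v w x
    using nsr_isoD(7)[OF that(1) proj_in[OF that(2,4)]] D.le_Ce_iff[OF that(3), of "h (v \<otimes>\<^bsub>A\<^esub> x)"]
    by auto
  note in1 = iso_in[OF h1 e u] and in2 = iso_in[OF h2 e' u']
  have closed: "\<phi> x \<in> carrier D" if "x \<in> carrier A" for x
    using in1 in2 that by (simp add: \<phi>_def)
  \<comment> \<open>Multiplication by \<open>u\<close> or \<open>u'\<close> recovers one image, so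
    \<open>\<phi>\<close> can be studied one factor at a time; \<open>extD\<close> puts the factors
    together.\<close>
  have comp1: "u \<otimes>\<^bsub>D\<^esub> \<phi> x = h1 (e \<otimes>\<^bsub>A\<^esub> x)" if "x \<in> carrier A" for x
    using D.Ce_glue(1)[OF u, of "h1 (e \<otimes>\<^bsub>A\<^esub> x)" "h2 (e' \<otimes>\<^bsub>A\<^esub> x)"] in1 in2 that
    by (simp add: \<phi>_def u'_def)
  have comp2: "u' \<otimes>\<^bsub>D\<^esub> \<phi> x = h2 (e' \<otimes>\<^bsub>A\<^esub> x)" if "x \<in> carrier A" for x
    using D.Ce_glue(2)[OF u, of "h1 (e \<otimes>\<^bsub>A\<^esub> x)" "h2 (e' \<otimes>\<^bsub>A\<^esub> x)"] in1 in2 that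
    by (simp add: \<phi>_def u'_def)
  have extD: "z = w" if "z \<in> carrier D" "w \<in> carrier D" "u \<otimes>\<^bsub>D\<^esub> z = u \<otimes>\<^bsub>D\<^esub> w"
    "u' \<otimes>\<^bsub>D\<^esub> z = u' \<otimes>\<^bsub>D\<^esub> w" for z w
    using D.Ce_ext[OF u that(1,2)] that(3,4) by (simp add: u'_def)
  \<comment> \<open>One statement serves both factors: \<open>(h, v, w)\<close> becomes
    \<open>(h1, e, u)\<close> and \<open>(h2, e', u')\<close>.\<close>
  have hom: "w \<otimes>\<^bsub>D\<^esub> \<phi> (x \<oplus>\<^bsub>A\<^esub> y) = w \<otimes>\<^bsub>D\<^esub> (\<phi> x \<oplus>\<^bsub>D\<^esub> \<phi> y)"
    "w \<otimes>\<^bsub>D\<^esub> \<phi> (x \<otimes>\<^bsub>A\<^esub> y) = w \<otimes>\<^bsub>D\<^esub> (\<phi> x \<otimes>\<^bsub>D\<^esub> \<phi> y)"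
    "w \<otimes>\<^bsub>D\<^esub> \<phi> (x\<^sup>\<alpha>\<^bsub>A\<^esub>) = w \<otimes>\<^bsub>D\<^esub> (\<phi> x)\<^sup>\<alpha>\<^bsub>D\<^esub>"
    "w \<otimes>\<^bsub>D\<^esub> \<phi> \<zero>\<^bsub>A\<^esub> = w \<otimes>\<^bsub>D\<^esub> \<zero>\<^bsub>D\<^esub>" "w \<otimes>\<^bsub>D\<^esub> \<phi> \<one>\<^bsub>A\<^esub> = w \<otimes>\<^bsub>D\<^esub> \<one>\<^bsub>D\<^esub>"
    if h: "h \<in> nsr_iso (interval_algebra A v) (interval_algebra D w)"
      and v: "v \<in> Ce A" and w: "w \<in> Ce D"
      and comp: "\<And>x. x \<in> carrier A \<Longrightarrow> w \<otimes>\<^bsub>D\<^esub> \<phi> x = h (v \<otimes>\<^bsub>A\<^esub> x)"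
      and x: "x \<in> carrier A" and y: "y \<in> carrier A" for h v w x y
  proof -
    note H = nsr_isoD(2-6)[OF h] and vx = proj_in[OF v x] and vy = proj_in[OF v y]
    show "w \<otimes>\<^bsub>D\<^esub> \<phi> (x \<oplus>\<^bsub>A\<^esub> y) = w \<otimes>\<^bsub>D\<^esub> (\<phi> x \<oplus>\<^bsub>D\<^esub> \<phi> y)"
      using H(1)[OF vx vy] A.Ce_hom(1)[OF v x y] D.Ce_hom(1)[OF w closed[OF x] closed[OF y]] x y
      by (simp add: comp)
    show "w \<otimes>\<^bsub>D\<^esub> \<phi> (x \<otimes>\<^bsub>A\<^esub> y) = w \<otimes>\<^bsub>D\<^esub> (\<phi> x \<otimes>\<^bsub>D\<^esub> \<phi> y)"
      using H(2)[OF vx vy] A.Ce_hom(2)[OF v x y] D.Ce_hom(2)[OF w closed[OF x] closed[OF y]] x y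
      by (simp add: comp)
    show "w \<otimes>\<^bsub>D\<^esub> \<phi> (x\<^sup>\<alpha>\<^bsub>A\<^esub>) = w \<otimes>\<^bsub>D\<^esub> (\<phi> x)\<^sup>\<alpha>\<^bsub>D\<^esub>"
      using H(3)[OF vx] A.Ce_hom_invol[OF v x] D.Ce_hom_invol[OF w closed[OF x]] x
      by (simp add: comp)
    show "w \<otimes>\<^bsub>D\<^esub> \<phi> \<zero>\<^bsub>A\<^esub> = w \<otimes>\<^bsub>D\<^esub> \<zero>\<^bsub>D\<^esub>" "w \<otimes>\<^bsub>D\<^esub> \<phi> \<one>\<^bsub>A\<^esub> = w \<otimes>\<^bsub>D\<^esub> \<one>\<^bsub>D\<^esub>"
      using H(4,5) v w by (simp_all add: comp)
  qed
  note hom1 = hom[OF h1 e u comp1] and hom2 = hom[OF h2 e' u' comp2]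
  have "\<phi> \<in> nsr_iso A D"
  proof (rule nsr_isoI)
    fix x y assume x: "x \<in> carrier A" and y: "y \<in> carrier A"
    show "\<phi> (x \<oplus>\<^bsub>A\<^esub> y) = \<phi> x \<oplus>\<^bsub>D\<^esub> \<phi> y"
      by (rule extD[OF _ _ hom1(1)[OF _ x y] hom2(1)[OF _ x y]]) (use closed x y in auto)
    show "\<phi> (x \<otimes>\<^bsub>A\<^esub> y) = \<phi> x \<otimes>\<^bsub>D\<^esub> \<phi> y"
      by (rule extD[OF _ _ hom1(2)[OF _ x y] hom2(2)[OF _ x y]]) (use closed x y in auto)
  next
    fix x assume x: "x \<in> carrier A"
    show "\<phi> (x\<^sup>\<alpha>\<^bsub>A\<^esub>) = (\<phi> x)\<^sup>\<alpha>\<^bsub>D\<^esub>"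
      by (rule extD[OF _ _ hom1(3)[OF _ x x] hom2(3)[OF _ x x]]) (use closed x in auto)
  next
    note 0 = A.zero_closed
    show "\<phi> \<zero>\<^bsub>A\<^esub> = \<zero>\<^bsub>D\<^esub>"
      by (rule extD[OF _ _ hom1(4)[OF _ 0 0] hom2(4)[OF _ 0 0]]) (use closed in auto)
    show "\<phi> \<one>\<^bsub>A\<^esub> = \<one>\<^bsub>D\<^esub>"
      by (rule extD[OF _ _ hom1(5)[OF _ 0 0] hom2(5)[OF _ 0 0]]) (use closed in auto)
  next
    have "inj_on \<phi> (carrier A)"
    proof (rule inj_onI)
      fix x y assume x: "x \<in> carrier A" and y: "y \<in> carrier A" and eq: "\<phi> x = \<phi> y"
      have "e \<otimes>\<^bsub>A\<^esub> x = e \<otimes>\<^bsub>A\<^esub> y"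
        using comp1[OF x] comp1[OF y] eq
        by (intro inj_onD[OF nsr_isoD(8)[OF h1]] proj_in e x y) simp
      moreover have "e' \<otimes>\<^bsub>A\<^esub> x = e' \<otimes>\<^bsub>A\<^esub> y"
        using comp2[OF x] comp2[OF y] eq
        by (intro inj_onD[OF nsr_isoD(8)[OF h2]] proj_in e' x y) simp
      ultimately show "x = y" using A.Ce_ext[OF e x y] by (simp add: e'_def)
    qed
    moreover have "z \<in> \<phi> ` carrier A" if z: "z \<in> carrier D" for z
    proof -
      have "u \<otimes>\<^bsub>D\<^esub> z \<in> h1 ` carrier (interval_algebra A e)"
        unfolding nsr_isoD(9)[OF h1] using D.Ce_mult_le(1)[OF u z] u z by simp
      then obtain x1 where x1: "x1 \<in> carrier (interval_algebra A e)" "h1 x1 = u \<otimes>\<^bsub>D\<^esub> z"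
        by (elim imageE) simp
      have "u' \<otimes>\<^bsub>D\<^esub> z \<in> h2 ` carrier (interval_algebra A e')"
        unfolding nsr_isoD(9)[OF h2] using D.Ce_mult_le(1)[OF u' z] u' z by simp
      then obtain x2 where x2: "x2 \<in> carrier (interval_algebra A e')" "h2 x2 = u' \<otimes>\<^bsub>D\<^esub> z"
        by (elim imageE) simp
      have ex: "x1 \<in> carrier A" "x2 \<in> carrier A" "e \<otimes>\<^bsub>A\<^esub> x1 = x1" "e' \<otimes>\<^bsub>A\<^esub> x2 = x2"
        using x1 x2 A.le_Ce_iff[OF e, of x1] A.le_Ce_iff[OF e', of x2] by auto
      \<comment> \<open>Preimages of the two components of \<open>z\<close> are glued to a preimage
        of \<open>z\<close>.\<close>
      define x where "x = x1 \<oplus>\<^bsub>A\<^esub> x2"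
      have x: "x \<in> carrier A" using ex by (simp add: x_def)
      have "e \<otimes>\<^bsub>A\<^esub> x = x1" "e' \<otimes>\<^bsub>A\<^esub> x = x2"
        using A.Ce_glue[OF e ex(1,2)] ex(3,4) by (simp_all add: x_def e'_def)
      then have "u \<otimes>\<^bsub>D\<^esub> \<phi> x = u \<otimes>\<^bsub>D\<^esub> z" "u' \<otimes>\<^bsub>D\<^esub> \<phi> x = u' \<otimes>\<^bsub>D\<^esub> z"
        using comp1[OF x] comp2[OF x] x1(2) x2(2) by simp_all
      then have "\<phi> x = z" by (rule extD[OF closed[OF x] z])
      then show ?thesis using x by blast
    qed
    ultimately show "bij_betw \<phi> (carrier A) (carrier D)"
      using closed by (auto simp: bij_betw_def)
  qed
  then show ?thesis by (auto simp: nsr_isomorphic_def)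
qed

section \<open>The Cantor-Bernstein argument\<close>

text \<open>The interval \<open>[0,a]\<close> is squeezed between \<open>A\<close> and its copy
  \<open>[0,c]\<close>; the join in the centre takes the place of the union in the proof for
  sets.\<close>

lemma (in iota_near_semiring) isomorphic_intermediate_interval:
  assumes sc: "sigma_complete_center A"
    and a: "a \<in> Ce A" and c: "c \<in> Ce A" and ca: "nsr_le A c a"
    and f: "f \<in> nsr_iso A (interval_algebra A c)"
  shows "nsr_isomorphic A (interval_algebra A a)"
proof -
  let ?C = "interval_algebra A c" and ?D = "interval_algebra A a"
  have A: "iota_near_semiring A" ..
  have C: "iota_near_semiring ?C" and D: "iota_near_semiring ?D"
    using a c by (auto intro: iota_near_semiring_interval)
  have fin: "f x \<in> carrier A" "nsr_le A (f x) c" if "x \<in> carrier A" for x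
    using nsr_isoD(7)[OF f that] by auto
  have f_le: "nsr_le A (f x) (f y) \<longleftrightarrow> nsr_le A x y" if "x \<in> carrier A" "y \<in> carrier A" for x y
    using nsr_iso_le_iff[OF f that] nsr_le_interval_iff[OF c] fin that by simp
  have f_Ce: "f x \<in> Ce A" if "x \<in> Ce A" for x
    using nsr_iso_Ce[OF A C f that] Ce_interval[OF c] by auto
  \<comment> \<open>\<open>a\<^sup>\<alpha>\<close> is the part of \<open>A\<close> left out by
    \<open>[0,a]\<close>; \<open>k = 0\<close> contributes it, larger \<open>k\<close> its iterated
    images.\<close>
  define X where "X = range (\<lambda>k. (f ^^ k) (a\<^sup>\<alpha>))"
  have X: "(f ^^ k) (a\<^sup>\<alpha>) \<in> Ce A" for k
    by (induction k) (auto intro: f_Ce Ce_invol a)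
  have "X \<subseteq> Ce A" "countable X" using X by (auto simp: X_def)
  then obtain s where s: "least (nsr_order A (Ce A)) s (Upper (nsr_order A (Ce A)) X)"
    using sc unfolding sigma_complete_center_def by blast
  have sCe: "s \<in> Ce A" and s_ub: "nsr_le A ((f ^^ k) (a\<^sup>\<alpha>)) s" for k
    using s X by (auto simp: least_def Upper_def nsr_order_def X_def)
  \<comment> \<open>The join is formed in \<open>Ce A\<close>, so every upper bound compared with
    \<open>s\<close> must be shown central.\<close>
  have s_least: "nsr_le A s z" if "z \<in> Ce A" "\<And>k. nsr_le A ((f ^^ k) (a\<^sup>\<alpha>)) z" for z
    using s that by (auto simp: least_def Upper_def nsr_order_def X_def)
  have [simp]: "s \<in> carrier A" "a \<in> carrier A" "c \<in> carrier A" "f s \<in> carrier A"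
    using sCe a c fin by auto
  have fsa: "nsr_le A (f s) a"
    using nsr_le_trans[OF fin(2) ca] by simp
  have s_eq: "s = a\<^sup>\<alpha> \<oplus> f s"
  proof (rule nsr_le_antisym)
    show "nsr_le A s (a\<^sup>\<alpha> \<oplus> f s)"
    proof (rule s_least)
      show "a\<^sup>\<alpha> \<oplus> f s \<in> Ce A" by (intro Ce_add Ce_invol a f_Ce sCe)
      show "nsr_le A ((f ^^ k) (a\<^sup>\<alpha>)) (a\<^sup>\<alpha> \<oplus> f s)" for k
      proof (cases k)
        case 0
        then show ?thesis by (simp add: nsr_le_add1)
      next
        case (Suc j)
        have "nsr_le A (f ((f ^^ j) (a\<^sup>\<alpha>))) (f s)"
          using f_le s_ub[of j] X[of j] by simp
        then show ?thesis
          using Suc X[of k] by (auto intro!: nsr_le_trans[OF _ nsr_le_add2])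
      qed
    qed
    \<comment> \<open>\<open>s\<close> need not lie in the range of \<open>f\<close>, but
      \<open>c \<otimes> s\<close> does. Its preimage \<open>w\<close> is a central upper bound of
      \<open>X\<close>, as \<open>f\<close> sends the \<open>k\<close>-th term to the next one,
      which lies below both \<open>c\<close> and \<open>s\<close>. Hence \<open>s \<le> w\<close>,
      and applying \<open>f\<close> gives \<open>f s \<le> c \<otimes> s \<le> s\<close>.\<close>
    have v: "c \<otimes> s \<in> Ce ?C"
      using Ce_interval[OF c] Ce_mult[OF c sCe] Ce_mult_le(1)[OF c] by simp
    define w where "w = inv_into (carrier A) f (c \<otimes> s)"
    have w: "w \<in> Ce A"
      unfolding w_def by (rule nsr_iso_Ce[OF C A nsr_iso_inv_into[OF f] v])
    have "c \<otimes> s \<in> f ` carrier A"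
      using v iota_near_semiring.Ce_closed[OF C] nsr_isoD(9)[OF f] by blast
    then have fw: "f w = c \<otimes> s" unfolding w_def by (rule f_inv_into_f)
    have "nsr_le A s w"
    proof (rule s_least[OF w])
      fix k
      have "nsr_le A ((f ^^ Suc k) (a\<^sup>\<alpha>)) (c \<otimes> s)"
        using s_ub[of "Suc k"] fin X[of k] X[of "Suc k"] by (intro Ce_le_multI c) auto
      then show "nsr_le A ((f ^^ k) (a\<^sup>\<alpha>)) w"
        using f_le[of "(f ^^ k) (a\<^sup>\<alpha>)" w] X[of k] w by (simp add: fw)
    qed
    then have "nsr_le A (f s) (c \<otimes> s)" using f_le[of s w] w by (simp add: fw)
    then have "nsr_le A (f s) s"
      by (rule nsr_le_trans) (use Ce_mult_le(2)[OF c] in auto)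
    then show "nsr_le A (a\<^sup>\<alpha> \<oplus> f s) s"
      using s_ub[of 0] by (intro nsr_le_add_lub) auto
  qed simp_all
  \<comment> \<open>De Morgan's law for the central \<open>a\<close>; \<open>f s\<close> is held
    fixed while \<open>a\<close> is replaced by \<zero> and \<one>.\<close>
  have s'_eq: "s\<^sup>\<alpha> = a \<otimes> (f s)\<^sup>\<alpha>"
    unfolding arg_cong[OF s_eq, of "invol A"]
    by (rule Ce_eqI[OF a, of "\<lambda>a. (a\<^sup>\<alpha> \<oplus> f s)\<^sup>\<alpha>" "\<lambda>a. a \<otimes> (f s)\<^sup>\<alpha>"])
      (simp_all add: compatible_intros)
  have to_D: "nsr_isomorphic (interval_algebra A x) (interval_algebra ?D x)"
    if x: "x \<in> Ce A" "nsr_le A x a" for x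
  proof (rule iota_near_semiring.nsr_isomorphic_sym)
    show "iota_near_semiring (interval_algebra ?D x)"
      using Ce_interval[OF a] x
      by (intro iota_near_semiring.iota_near_semiring_interval[OF D]) simp
    show "nsr_isomorphic (interval_algebra ?D x) (interval_algebra A x)"
      using interval_interval_iso[OF a Ce_closed x(2)] x by (auto simp: nsr_isomorphic_def)
  qed
  show ?thesis
  proof (rule nsr_isomorphic_glue[OF A D sCe])
    show "f s \<in> Ce ?D" using Ce_interval[OF a] f_Ce[OF sCe] fsa by simp
    have "nsr_isomorphic (interval_algebra A s) (interval_algebra ?C (f s))"
      using nsr_iso_interval[OF f, of s] by (auto simp: nsr_isomorphic_def)
    also have "nsr_isomorphic \<dots> (interval_algebra A (f s))"
      using interval_interval_iso[OF c, of "f s"] fin(2)[of s] by (auto simp: nsr_isomorphic_def)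
    also have "nsr_isomorphic \<dots> (interval_algebra ?D (f s))"
      by (intro to_D f_Ce sCe fsa)
    finally show "nsr_isomorphic (interval_algebra A s) (interval_algebra ?D (f s))" .
    have "nsr_le A (s\<^sup>\<alpha>) a" unfolding s'_eq by (rule Ce_mult_le[OF a]) simp
    \<comment> \<open>The complement of \<open>f s\<close> in \<open>[0,a]\<close> is
      \<open>a \<otimes> (f s)\<^sup>\<alpha> = s\<^sup>\<alpha>\<close>, so on this factor the two
      sides are the same interval, formed in \<open>A\<close> and in \<open>[0,a]\<close>.\<close>
    then show "nsr_isomorphic (interval_algebra A (s\<^sup>\<alpha>)) (interval_algebra ?D ((f s)\<^sup>\<alpha>\<^bsub>?D\<^esub>))"
      using to_D[OF Ce_invol[OF sCe]] by (simp add: s'_eq)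
  qed
qed

theorem theorem10:
  fixes A :: "'a near_semiring" and B :: "'b near_semiring"
  assumes "iota_near_semiring A" and "iota_near_semiring B"
    and "join_sigma_complete A" and "join_sigma_complete B"
    and "sigma_complete_center A" and "sigma_complete_center B"
    and "\<exists>a\<in>Ce A. \<exists>b\<in>Ce B.
           nsr_isomorphic A (interval_algebra B b) \<and> nsr_isomorphic B (interval_algebra A a)"
  shows "nsr_isomorphic A B"
proof -
  interpret A: iota_near_semiring A by fact
  interpret B: iota_near_semiring B by fact
  from assms(7) obtain a b g h where a: "a \<in> Ce A" and b: "b \<in> Ce B"
    and g: "g \<in> nsr_iso A (interval_algebra B b)" and h: "h \<in> nsr_iso B (interval_algebra A a)"
    by (auto simp: nsr_isomorphic_def)
  have D: "iota_near_semiring (interval_algebra A a)"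
    by (rule A.iota_near_semiring_interval[OF a])
  \<comment> \<open>\<open>h\<close> carries \<open>[0,b]\<close>, a copy of \<open>A\<close>, onto
    the elements below \<open>h b\<close>.\<close>
  define c where "c = h b"
  have c: "c \<in> Ce A" "nsr_le A c a"
    using nsr_iso_Ce[OF assms(2) D h b] A.Ce_interval[OF a] by (auto simp: c_def)
  have "h \<in> nsr_iso (interval_algebra B b) (interval_algebra (interval_algebra A a) c)"
    unfolding c_def using b by (intro B.nsr_iso_interval[OF h]) simp
  \<comment> \<open>\<open>g\<close>, then \<open>h\<close>, then the collapse of the nested
    interval give an isomorphism from \<open>A\<close> to \<open>[0,c]\<close>.\<close>
  from nsr_iso_comp[OF nsr_iso_comp[OF g this] A.interval_interval_iso[OF a _ c(2)]]
  have "nsr_isomorphic A (interval_algebra A a)"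
    using A.isomorphic_intermediate_interval[OF assms(5) a c] c by simp
  moreover have "nsr_isomorphic (interval_algebra A a) B"
    using h by (intro B.nsr_isomorphic_sym) (auto simp: nsr_isomorphic_def)
  ultimately show ?thesis by (rule nsr_isomorphic_trans)
qed

end
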